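(* Let $p=r/s\in(0,1)$, where $r$ and $s$ are coprime positive integers, and set \[ A:=2s-r,\qquad B:=s-r,\qquad \kappa:=\frac{A^A}{B^B s^s}. \] For $j=1,\ldots,s$, define \[ \alpha_j:=\frac{Aj}{s}-1,\qquad \beta_j:=\frac{Bj}{s},\qquad C_j:=\frac{\Gamma(\alpha_j)}{\Gamma(\beta_j)\Gamma(j+1)}, \] and the parameter multisets \[ \mathcal A_j:=\left\{\tfrac{\alpha_j+k}{A}:k=0,\ldots,A-1\right\}, \] \[ \mathcal B_j:=\left(\left\{\tfrac{\beta_j+k}{B}:k=0,\ldots,B-1\right\}\cup\left\{\tfrac{j+1+k}{s}:k=0,\ldots,s-1\right\}\right)\setminus\{1\}, \] where the union is a multiset union and one occurrence of $1$ is removed. Then, for $|\varepsilon|<u_\star$, \[ z(\varepsilon)=1-\sum_{j=1}^{s}C_j\,\varepsilon^j\;{}_{A}F_{A-1}\!\left(\mathcal A_j;\mathcal B_j;\kappa\varepsilon^s\right). \] Moreover, $\kappa u_\star^s=1$, so each hypergeometric argument $\kappa\varepsilon^s$ has modulus less than one on the disk of convergence $\{|\varepsilon|<u_\star\}$ of $z$.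
   Context: For $0<p<1$ set \[ u_\star:=\frac{(1-p)^{1-p}}{(2-p)^{2-p}},\qquad z(\varepsilon):=1-\sum_{n=1}^{\infty}\frac{\varepsilon^n}{n!}\,\frac{\Gamma(n(2-p)-1)}{\Gamma(n(1-p))}, \] a power series with radius of convergence $u_\star$. With the rising Pochhammer symbol $(a)_n:=a(a+1)\cdots(a+n-1)$, $(a)_0=1$, the generalized hypergeometric function is \[ {}_{\alpha}F_{\beta}(a_1,\ldots,a_\alpha;b_1,\ldots,b_\beta;x)=\sum_{n=0}^\infty\frac{(a_1)_n\cdots(a_\alpha)_n}{(b_1)_n\cdots(b_\beta)_n}\frac{x^n}{n!}. \] Writing multisets as parameter lists means listing their elements with multiplicity. *)

theory Defs
  imports "HOL-Analysis.Analysis" "HOL-Library.Multiset"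
begin

definition u_star :: "real \<Rightarrow> real" where
  "u_star p = (1 - p) powr (1 - p) / (2 - p) powr (2 - p)"

text \<open>Only the coefficients with \<open>n \<ge> 1\<close> are meant. The entry at \<open>0\<close> is an artefact of the
  totalised Gamma function; it is not used by \<open>z\<close> and does not affect the radius of convergence.\<close>

definition z_coeff :: "real \<Rightarrow> nat \<Rightarrow> complex" where
  "z_coeff p n =
     complex_of_real (1 / fact n * (Gamma (real n * (2 - p) - 1) / Gamma (real n * (1 - p))))"

definition z :: "real \<Rightarrow> complex \<Rightarrow> complex" where
  "z p \<epsilon> = 1 - (\<Sum>n. z_coeff p (Suc n) * \<epsilon> ^ Suc n)"

definition hypergeom_term :: "complex multiset \<Rightarrow> complex multiset \<Rightarrow> complex \<Rightarrow> nat \<Rightarrow> complex" where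
  "hypergeom_term as bs x n =
     (\<Prod>a\<in>#as. pochhammer a n) / (\<Prod>b\<in>#bs. pochhammer b n) * (x ^ n / fact n)"

text \<open>The two subscripts of the usual notation are the sizes of the two parameter multisets.\<close>

definition hypergeom :: "complex multiset \<Rightarrow> complex multiset \<Rightarrow> complex \<Rightarrow> complex" where
  "hypergeom as bs x = (\<Sum>n. hypergeom_term as bs x n)"

text \<open>In everything below, \<open>0 < r < s\<close>, so the subtractions on \<open>nat\<close> do not truncate.\<close>

definition par_A :: "nat \<Rightarrow> nat \<Rightarrow> nat" where
  "par_A r s = 2 * s - r"

definition par_B :: "nat \<Rightarrow> nat \<Rightarrow> nat" where
  "par_B r s = s - r"

definition kappa :: "nat \<Rightarrow> nat \<Rightarrow> real" where
  "kappa r s = real (par_A r s) ^ par_A r s / (real (par_B r s) ^ par_B r s * real s ^ s)"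

definition alpha :: "nat \<Rightarrow> nat \<Rightarrow> nat \<Rightarrow> real" where
  "alpha r s j = real (par_A r s) * real j / real s - 1"

definition beta :: "nat \<Rightarrow> nat \<Rightarrow> nat \<Rightarrow> real" where
  "beta r s j = real (par_B r s) * real j / real s"

definition C_coeff :: "nat \<Rightarrow> nat \<Rightarrow> nat \<Rightarrow> real" where
  "C_coeff r s j = Gamma (alpha r s j) / (Gamma (beta r s j) * Gamma (real j + 1))"

definition A_mset :: "nat \<Rightarrow> nat \<Rightarrow> nat \<Rightarrow> complex multiset" where
  "A_mset r s j =
     {# complex_of_real ((alpha r s j + real k) / real (par_A r s)). k \<in># mset_set {..<par_A r s} #}"

definition B_union :: "nat \<Rightarrow> nat \<Rightarrow> nat \<Rightarrow> complex multiset" where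
  "B_union r s j =
     {# complex_of_real ((beta r s j + real k) / real (par_B r s)). k \<in># mset_set {..<par_B r s} #}
     + {# complex_of_real ((real j + 1 + real k) / real s). k \<in># mset_set {..<s} #}"

definition B_mset :: "nat \<Rightarrow> nat \<Rightarrow> nat \<Rightarrow> complex multiset" where
  "B_mset r s j = B_union r s j - {#1#}"

text \<open>The next three facts check that \<open>1\<close> really occurs in the union, so that removing it is
  not vacuous, and that the parameter multisets have the sizes \<open>A\<close> and \<open>A - 1\<close>.\<close>

lemma one_in_B_union:
  assumes "r < s" "j \<in> {1..s}"
  shows "1 \<in># B_union r s j"
proof (cases "j = s")
  case True
  have "(1::complex) = complex_of_real ((beta r s j + real 0) / real (par_B r s))"
    using assms True by (simp add: beta_def par_B_def)
  moreover have "0 \<in> {..<par_B r s}"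
    using assms by (simp add: par_B_def)
  ultimately have "1 \<in> (\<lambda>k. complex_of_real ((beta r s j + real k) / real (par_B r s))) ` {..<par_B r s}"
    by (rule image_eqI)
  then show ?thesis
    unfolding B_union_def by (simp only: set_mset_union set_image_mset finite_set_mset_mset_set finite_lessThan Un_iff simp_thms)
next
  case False
  have "(1::complex) = complex_of_real ((real j + 1 + real (s - 1 - j)) / real s)"
    using assms False by simp
  moreover have "s - 1 - j \<in> {..<s}"
    using assms by auto
  ultimately have "1 \<in> (\<lambda>k. complex_of_real ((real j + 1 + real k) / real s)) ` {..<s}"
    by (rule image_eqI)
  then show ?thesis
    unfolding B_union_def by (simp only: set_mset_union set_image_mset finite_set_mset_mset_set finite_lessThan Un_iff simp_thms)
qed

lemma size_A_mset: "size (A_mset r s j) = par_A r s"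
  by (simp add: A_mset_def)

lemma size_B_mset:
  assumes "r < s" "j \<in> {1..s}"
  shows "size (B_mset r s j) = par_A r s - 1"
proof -
  have "size (B_union r s j) = par_A r s"
    using assms by (simp add: B_union_def par_A_def par_B_def)
  then show ?thesis
    using one_in_B_union[OF assms] by (simp add: B_mset_def size_Diff_singleton)
qed

end

theory Submission
  imports Defs
begin

text \<open>
  Split the series for \<open>z\<close> according to the residue of the index modulo \<open>s\<close>, taking
  \<open>1, \<dots>, s\<close> as representatives. Along \<open>n = j + s m\<close> each of the three Gamma arguments of
  the coefficient, \<open>n (2 - p) - 1\<close>, \<open>n (1 - p)\<close> and \<open>n + 1\<close>, moves by an integer,
  namely \<open>A m\<close>, \<open>B m\<close> and \<open>s m\<close>, so each Gamma value is its value at \<open>m = 0\<close> times a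
  rising factorial of length \<open>A m\<close>, \<open>B m\<close> or \<open>s m\<close>. A rising factorial of length
  \<open>A m\<close> splits into \<open>A\<close> rising factorials of length \<open>m\<close> with the scaled parameters
  \<open>(x + k) / A\<close>, at the price of a factor \<open>A ^ (A m)\<close> (\<open>Gamma_add_mult_index\<close>). The
  scaling factors combine to \<open>\<kappa> ^ m\<close>, and the parameters are those of \<open>\<A>\<^sub>j\<close> and of the union
  in \<open>\<B>\<^sub>j\<close>; the parameter \<open>1\<close> in that union supplies the \<open>m!\<close> of the hypergeometric
  series (\<open>z_coeff_residue_class\<close>).

  For convergence, a series with one more upper than lower parameter has radius \<open>1\<close> by the
  ratio test (\<open>conv_radius_hypergeom_coeff\<close>), and \<open>\<kappa> u\<^sub>\<star> ^ s = 1\<close> turns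
  \<open>\<bar>\<epsilon>\<bar> < u\<^sub>\<star>\<close> into \<open>\<bar>\<kappa> \<epsilon> ^ s\<bar> < 1\<close>. Hence the \<open>s\<close> subseries converge absolutely inside
  the disk, which makes the whole series converge there and justifies the rearrangement.
  Outside the disk already the subseries \<open>j = 1\<close> diverges, so the radius is exactly
  \<open>u\<^sub>\<star>\<close>.
\<close>

section \<open>Gamma values along an arithmetic progression\<close>

text \<open>The discrete counterpart of the Gauss multiplication formula: the \<open>A * m\<close> consecutive factors
  \<open>z + i\<close> are sorted by \<open>i mod A\<close>. In the induction step the \<open>A\<close> new factors contribute exactly
  one to each of the \<open>A\<close> products on the right.\<close>

lemma pochhammer_mult_index:
  fixes z :: "'a :: field_char_0"
  assumes "A > 0"
  shows "pochhammer z (A * m) =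
           of_nat A ^ (A * m) * (\<Prod>k<A. pochhammer ((z + of_nat k) / of_nat A) m)"
proof (induction m)
  case (Suc m)
  have "pochhammer (z + of_nat (A * m)) A = (\<Prod>k<A. z + of_nat (A * m) + of_nat k)"
    by (simp add: pochhammer_prod atLeast0LessThan)
  also have "\<dots> = (\<Prod>k<A. of_nat A * ((z + of_nat k) / of_nat A + of_nat m))"
    using assms by (intro prod.cong) (auto simp: field_simps)
  finally have "pochhammer (z + of_nat (A * m)) A =
      of_nat A ^ A * (\<Prod>k<A. (z + of_nat k) / of_nat A + of_nat m)"
    by (simp add: prod.distrib)
  moreover have "pochhammer z (A * Suc m) = pochhammer z (A * m) * pochhammer (z + of_nat (A * m)) A"
    using pochhammer_product'[of z "A * m" A] by (simp add: algebra_simps)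
  ultimately show ?case
    using Suc by (simp add: pochhammer_Suc prod.distrib power_add)
qed simp

lemma Gamma_add_mult_index:
  fixes x :: real
  assumes "x > 0" "A > 0"
  shows "Gamma (x + real A * real m) =
           Gamma x * (real A ^ A) ^ m * (\<Prod>k<A. pochhammer ((x + real k) / real A) m)"
proof -
  have "x \<notin> \<int>\<^sub>\<le>\<^sub>0"
    using assms nonpos_Ints_nonpos by fastforce
  then have "pochhammer x (A * m) = Gamma (x + real (A * m)) / Gamma x"
    by (rule pochhammer_Gamma)
  moreover have "Gamma x \<noteq> 0"
    using Gamma_real_pos[OF assms(1)] by simp
  ultimately have "Gamma (x + real A * real m) = Gamma x * pochhammer x (A * m)"
    by (simp add: field_simps)
  then show ?thesis
    by (simp add: pochhammer_mult_index[OF assms(2)] power_mult)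
qed

section \<open>Radius of convergence of hypergeometric series\<close>

lemma tendsto_prod_mset_ratio_1:
  fixes as :: "complex multiset"
  shows "(\<lambda>n. (\<Prod>a\<in>#as. (a + of_nat n) / of_nat (Suc n))) \<longlonglongrightarrow> 1"
proof (induction as)
  case (add a as)
  have "(\<lambda>n. (a - 1) * inverse (of_nat (Suc n)) + 1) \<longlonglongrightarrow> (a - 1) * 0 + 1"
    by (intro tendsto_intros LIMSEQ_Suc[OF lim_inverse_n])
  moreover have "(a - 1) * inverse (of_nat (Suc n)) + 1 = (a + of_nat n) / of_nat (Suc n)" for n :: nat
  proof -
    have "of_nat (Suc n) \<noteq> (0 :: complex)" by (rule of_nat_neq_0)
    then have "(a - 1) * inverse (of_nat (Suc n)) + 1 = (a - 1 + of_nat (Suc n)) / of_nat (Suc n)"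
      by (simp add: divide_inverse distrib_right del: of_nat_Suc)
    then show ?thesis by simp
  qed
  ultimately have "(\<lambda>n. (a + of_nat n) / of_nat (Suc n)) \<longlonglongrightarrow> 1"
    by simp
  from tendsto_mult[OF this add.IH] show ?case by simp
qed simp

text \<open>Separating the coefficient from the power of the argument makes the theory of the radius of
  convergence applicable.\<close>

definition hypergeom_coeff :: "complex multiset \<Rightarrow> complex multiset \<Rightarrow> nat \<Rightarrow> complex" where
  "hypergeom_coeff as bs n =
     (\<Prod>a\<in>#as. pochhammer a n) / (\<Prod>b\<in>#bs. pochhammer b n) / fact n"

lemma hypergeom_term_eq: "hypergeom_term as bs x n = hypergeom_coeff as bs n * x ^ n"
  by (simp add: hypergeom_term_def hypergeom_coeff_def)

lemma prod_mset_pochhammer_nonzero: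
  fixes as :: "complex multiset"
  assumes "\<And>a. a \<in># as \<Longrightarrow> a \<notin> \<int>\<^sub>\<le>\<^sub>0"
  shows "(\<Prod>a\<in>#as. pochhammer a n) \<noteq> 0"
proof -
  have "pochhammer a n \<noteq> 0" if "a \<in># as" for a
    using assms[OF that] by (metis pochhammer_eq_0_iff minus_of_nat_in_nonpos_Ints)
  then have "0 \<notin># image_mset (\<lambda>a. pochhammer a n) as" by fastforce
  then show ?thesis by (simp only: prod_mset_zero_iff not_False_eq_True)
qed

text \<open>Pulling out \<open>of_nat (Suc n)\<close> once per parameter leaves factors that tend to \<open>1\<close>: in the
  limit, the step from \<open>n\<close> to \<open>Suc n\<close> sees only the number of parameters.\<close>

lemma prod_mset_pochhammer_Suc:
  fixes as :: "complex multiset"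
  shows "(\<Prod>a\<in>#as. pochhammer a (Suc n)) =
         of_nat (Suc n) ^ size as * (\<Prod>a\<in>#as. pochhammer a n) *
         (\<Prod>a\<in>#as. (a + of_nat n) / of_nat (Suc n))"
  by (induction as) (simp_all add: pochhammer_Suc field_simps del: of_nat_Suc)

text \<open>With one more upper than lower parameter, the surplus factor \<open>Suc n\<close> in the quotient of
  consecutive coefficients cancels against the one from \<open>fact (Suc n)\<close>, so the quotient tends
  to \<open>1\<close>. Excluding the nonpositive integers keeps all coefficients nonzero and all denominators
  meaningful.\<close>

lemma conv_radius_hypergeom_coeff:
  assumes "size as = Suc (size bs)"
    and as: "\<And>a. a \<in># as \<Longrightarrow> a \<notin> \<int>\<^sub>\<le>\<^sub>0" and bs: "\<And>b. b \<in># bs \<Longrightarrow> b \<notin> \<int>\<^sub>\<le>\<^sub>0"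
  shows "conv_radius (hypergeom_coeff as bs) = 1"
proof -
  let ?c = "hypergeom_coeff as bs"
  let ?P = "\<lambda>as n. \<Prod>a\<in>#as. pochhammer (a::complex) n"
  let ?R = "\<lambda>as n. \<Prod>a\<in>#as. (a + of_nat n) / (of_nat (Suc n) :: complex)"
  have nzP: "?P as n \<noteq> 0" "?P bs n \<noteq> 0" for n
    using prod_mset_pochhammer_nonzero as bs by blast+
  have ratio: "?c n / ?c (Suc n) = ?R bs n / ?R as n" for n
  proof -
    have "?c (Suc n) = ?c n * (?R as n / ?R bs n)"
      using nzP[of n] unfolding hypergeom_coeff_def prod_mset_pochhammer_Suc assms(1) fact_Suc
      by (simp add: field_simps del: of_nat_Suc)
    moreover have "?c n \<noteq> 0" using nzP by (simp add: hypergeom_coeff_def)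
    ultimately show ?thesis by simp
  qed
  have "(\<lambda>n. ?R bs n / ?R as n) \<longlonglongrightarrow> 1 / 1"
    by (intro tendsto_divide tendsto_prod_mset_ratio_1) simp
  then have "(\<lambda>n. norm (?c n / ?c (Suc n))) \<longlonglongrightarrow> norm (1 / 1 :: complex)"
    unfolding ratio by (rule tendsto_norm)
  then have "(\<lambda>n. norm (?c n) / norm (?c (Suc n))) \<longlonglongrightarrow> 1"
    by (simp add: norm_divide)
  moreover have "?c n \<noteq> 0" for n using nzP by (simp add: hypergeom_coeff_def)
  ultimately have "conv_radius ?c = ereal 1"
    by (intro conv_radius_ratio_limit_nonzero[where c = 1]) auto
  then show ?thesis by simp
qed

section \<open>The coefficients in one residue class\<close>

lemma kappa_mult_u_star_power:
  assumes "0 < r" "r < s" "p = real r / real s"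
  shows "kappa r s * u_star p ^ s = 1"
proof -
  let ?A = "real (par_A r s)" and ?B = "real (par_B r s)" and ?s = "real s"
  have pos: "?A > 0" "?B > 0" "?s > 0"
    using assms by (auto simp: par_A_def par_B_def)
  have p: "1 - p = ?B / ?s" "2 - p = ?A / ?s"
    using assms by (auto simp: par_A_def par_B_def of_nat_diff field_simps)
  \<comment> \<open>The \<open>s\<close>-th power clears the denominators of the exponents \<open>B / s\<close> and \<open>A / s\<close>.\<close>
  have root: "((real k / ?s) powr (real k / ?s)) ^ s = (real k / ?s) ^ k" if "real k > 0" for k
    using that pos by (simp add: powr_power powr_realpow)
  have "u_star p ^ s = (?B / ?s) ^ par_B r s / (?A / ?s) ^ par_A r s"
    unfolding u_star_def p power_divide[of "_ powr _" "_ powr _"] using root pos by simp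
  also have "\<dots> = ?B ^ par_B r s * ?s ^ s / ?A ^ par_A r s"
  proof -
    have "par_A r s = par_B r s + s" using assms by (simp add: par_A_def par_B_def)
    then have "?s ^ par_A r s = ?s ^ par_B r s * ?s ^ s" by (simp add: power_add)
    then show ?thesis using pos by (simp add: power_divide field_simps)
  qed
  finally show ?thesis using pos by (simp add: kappa_def)
qed

text \<open>Removing the parameter \<open>1\<close> drops the factor \<open>pochhammer 1 m = fact m\<close>.\<close>

lemma prod_mset_B_mset:
  assumes "r < s" "j \<in> {1..s}"
  shows "(\<Prod>b\<in>#B_mset r s j. pochhammer b m) * fact m = (\<Prod>b\<in>#B_union r s j. pochhammer b m)"
proof -
  have "B_union r s j = add_mset 1 (B_mset r s j)"
    using one_in_B_union[OF assms] by (simp add: B_mset_def)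
  then show ?thesis by (simp add: pochhammer_fact)
qed

text \<open>Even for \<open>j = 1\<close> the subtraction of \<open>1\<close> leaves a positive number, because \<open>A > s\<close>; so no pole of
  the Gamma function is met.\<close>

lemma alpha_pos:
  assumes "r < s" "j \<ge> 1"
  shows "alpha r s j > 0"
proof -
  have "s * 1 < par_A r s * j"
    using assms by (intro less_le_trans[OF _ mult_le_mono2[of 1 j]]) (auto simp: par_A_def)
  then have "real s < real (par_A r s) * real j"
    by (metis mult.right_neutral of_nat_less_iff of_nat_mult)
  then show ?thesis using assms by (simp add: alpha_def field_simps)
qed

lemma beta_pos: "r < s \<Longrightarrow> j \<ge> 1 \<Longrightarrow> beta r s j > 0"
  by (simp add: beta_def par_B_def)

text \<open>All three Gamma values are expanded at \<open>m = 0\<close>; what remains at \<open>m = 0\<close> is \<open>C\<^sub>j\<close>, the scaling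
  factors are \<open>\<kappa> ^ m\<close>, and the rising factorials are those of the two parameter multisets.\<close>

lemma z_coeff_residue_class:
  assumes "r < s" "p = real r / real s" "j \<in> {1..s}"
  shows "z_coeff p (j + s * m) =
           of_real (C_coeff r s j) * hypergeom_coeff (A_mset r s j) (B_mset r s j) m *
           of_real (kappa r s) ^ m"
proof -
  let ?A = "par_A r s" and ?B = "par_B r s"
  have pos: "?A > 0" "?B > 0" "s > 0" "j \<ge> 1"
    using assms by (auto simp: par_A_def par_B_def)
  have p: "2 - p = real ?A / real s" "1 - p = real ?B / real s"
    using assms by (auto simp: par_A_def par_B_def of_nat_diff field_simps)
  have arg: "real (j + s * m) * (2 - p) - 1 = alpha r s j + real ?A * real m"
            "real (j + s * m) * (1 - p) = beta r s j + real ?B * real m"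
    unfolding p alpha_def beta_def using pos by (simp_all add: field_simps)
  have fact_eq: "fact (j + s * m) = Gamma ((real j + 1) + real s * real m)"
    by (simp add: Gamma_fact[symmetric] add_ac)
  define PA PB PS where
    "PA = (\<Prod>k<?A. pochhammer ((alpha r s j + real k) / real ?A) m)" and
    "PB = (\<Prod>k<?B. pochhammer ((beta r s j + real k) / real ?B) m)" and
    "PS = (\<Prod>k<s. pochhammer ((real j + 1 + real k) / real s) m)"
  have "z_coeff p (j + s * m) = of_real (C_coeff r s j * (PA / (PB * PS)) * kappa r s ^ m)"
    unfolding z_coeff_def arg fact_eq PA_def PB_def PS_def C_coeff_def kappa_def
    using alpha_pos[OF assms(1) pos(4)] beta_pos[OF assms(1) pos(4)] pos
    by (subst (1 2 3) Gamma_add_mult_index)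
       (simp_all add: power_divide power_mult_distrib mult_ac)
  moreover have "(\<Prod>a\<in>#A_mset r s j. pochhammer a m) = of_real PA"
    by (simp add: A_mset_def PA_def prod_unfold_prod_mset[symmetric] image_mset.compositionality
          o_def pochhammer_of_real[symmetric])
  moreover have "(\<Prod>b\<in>#B_union r s j. pochhammer b m) = of_real (PB * PS)"
    by (simp add: B_union_def PB_def PS_def prod_unfold_prod_mset[symmetric] image_mset.compositionality
          o_def pochhammer_of_real[symmetric])
  ultimately show ?thesis
    using prod_mset_B_mset[OF assms(1,3), of m]
    by (simp add: hypergeom_coeff_def)
qed

lemma conv_radius_hypergeom_coeff_A_B:
  assumes "r < s" "j \<in> {1..s}"
  shows "conv_radius (hypergeom_coeff (A_mset r s j) (B_mset r s j)) = 1"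
proof (rule conv_radius_hypergeom_coeff)
  have nonpos: "of_real x \<notin> (\<int>\<^sub>\<le>\<^sub>0 :: complex set)" if "x > 0" for x
    using that nonpos_Ints_nonpos[of x] by (auto simp: of_real_in_nonpos_Ints_iff)
  have A: "par_A r s > 0" and B: "par_B r s > 0" and s: "s > 0" and j: "j \<ge> 1"
    using assms by (auto simp: par_A_def par_B_def)
  have "size (B_mset r s j) = par_A r s - 1"
    using size_B_mset[OF assms] .
  then show "size (A_mset r s j) = Suc (size (B_mset r s j))"
    using A by (simp add: size_A_mset)
  show "a \<notin> \<int>\<^sub>\<le>\<^sub>0" if "a \<in># A_mset r s j" for a
    using that alpha_pos[OF assms(1) j] A
    by (auto simp: A_mset_def simp del: of_real_add of_real_divide
             intro!: nonpos divide_pos_pos add_pos_nonneg)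
  show "b \<notin> \<int>\<^sub>\<le>\<^sub>0" if "b \<in># B_mset r s j" for b
  proof -
    have "b \<in># B_union r s j"
      using that by (auto simp: B_mset_def dest: in_diffD)
    then consider k where "b = of_real ((beta r s j + real k) / real (par_B r s))"
      | k where "b = of_real ((real j + 1 + real k) / real s)"
      unfolding B_union_def set_mset_union set_image_mset by blast
    then show ?thesis
    proof cases
      case 1
      have "(beta r s j + real k) / real (par_B r s) > 0"
        using beta_pos[OF assms(1) j] B by (intro divide_pos_pos add_pos_nonneg) simp_all
      then show ?thesis unfolding 1 by (rule nonpos)
    next
      case 2
      have "(real j + 1 + real k) / real s > 0"
        using s by (intro divide_pos_pos) simp_all
      then show ?thesis unfolding 2 by (rule nonpos)
    qed
  qed
qed

section \<open>Splitting a series into residue classes\<close>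

lemma summable_norm_of_residue_classes:
  fixes f :: "nat \<Rightarrow> 'a :: banach"
  assumes "s > 0" and "\<And>i. i < s \<Longrightarrow> summable (\<lambda>m. norm (f (m * s + i)))"
  shows "summable (\<lambda>n. norm (f n))"
proof (rule summableI_nonneg_bounded)
  fix N
  have "(\<Sum>n<N. norm (f n)) \<le> (\<Sum>n<N * s. norm (f n))"
    using assms(1) by (intro sum_mono2) auto
  also have "\<dots> = (\<Sum>m<N. \<Sum>n\<in>{m * s..<m * s + s}. norm (f n))"
    by (rule sum.nat_group[symmetric])
  also have "\<dots> = (\<Sum>m<N. \<Sum>i<s. norm (f (m * s + i)))"
    by (simp add: sum.shift_bounds_nat_ivl[of _ 0 _ s, simplified] atLeast0LessThan add.commute)
  also have "\<dots> = (\<Sum>i<s. \<Sum>m<N. norm (f (m * s + i)))"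
    by (rule sum.swap)
  also have "\<dots> \<le> (\<Sum>i<s. \<Sum>m. norm (f (m * s + i)))"
    using assms(2) by (intro sum_mono sum_le_suminf) auto
  finally show "(\<Sum>n<N. norm (f n)) \<le> (\<Sum>i<s. \<Sum>m. norm (f (m * s + i)))" .
qed simp

text \<open>The blocks of \<open>s\<close> consecutive terms can be summed first, and a finite sum of series may be
  interchanged with the summation.\<close>

lemma suminf_split_residue_classes:
  fixes f :: "nat \<Rightarrow> 'a :: banach"
  assumes "s > 0" and "\<And>i. i < s \<Longrightarrow> summable (\<lambda>m. norm (f (m * s + i)))"
  shows "(\<Sum>n. f n) = (\<Sum>i<s. \<Sum>m. f (m * s + i))"
proof -
  have "summable f"
    using summable_norm_of_residue_classes[OF assms] by (rule summable_norm_cancel)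
  then have "(\<lambda>m. sum f {m * s..<m * s + s}) sums (\<Sum>n. f n)"
    using assms(1) by (intro sums_group summable_sums) auto
  moreover have "sum f {m * s..<m * s + s} = (\<Sum>i<s. f (m * s + i))" for m
    by (simp add: sum.shift_bounds_nat_ivl[of _ 0 _ s, simplified] atLeast0LessThan add.commute)
  ultimately have "(\<Sum>n. f n) = (\<Sum>m. \<Sum>i<s. f (m * s + i))"
    by (simp add: sums_iff)
  also have "\<dots> = (\<Sum>i<s. \<Sum>m. f (m * s + i))"
    using assms(2) by (intro suminf_sum summable_norm_cancel[of "\<lambda>m. f (m * s + _)"]) auto
  finally show ?thesis .
qed

section \<open>Convergence and the decomposition of z\<close>

lemma z_coeff_term_eq_hypergeom_term:
  assumes "r < s" "p = real r / real s" "j \<in> {1..s}"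
  shows "z_coeff p (j + s * m) * \<epsilon> ^ (j + s * m) =
           of_real (C_coeff r s j) * \<epsilon> ^ j *
           hypergeom_term (A_mset r s j) (B_mset r s j) (of_real (kappa r s) * \<epsilon> ^ s) m"
  unfolding z_coeff_residue_class[OF assms] hypergeom_term_eq power_add power_mult power_mult_distrib
  by (simp only: mult_ac)

lemma u_star_pos: "0 < p \<Longrightarrow> p < 1 \<Longrightarrow> u_star p > 0"
  by (simp add: u_star_def)

lemma kappa_pos: "r < s \<Longrightarrow> kappa r s > 0"
  by (simp add: kappa_def par_A_def par_B_def)

lemma norm_kappa_mult_power:
  assumes "0 < r" "r < s" "p = real r / real s"
  shows "norm (of_real (kappa r s) * \<epsilon> ^ s :: complex) = (norm \<epsilon> / u_star p) ^ s"
proof -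
  have "p > 0" "p < 1" using assms by auto
  then have "u_star p > 0" by (rule u_star_pos)
  then have "kappa r s = 1 / u_star p ^ s"
    using kappa_mult_u_star_power[OF assms] by (simp add: field_simps)
  moreover have "norm (of_real (kappa r s) * \<epsilon> ^ s) = kappa r s * norm \<epsilon> ^ s"
    using kappa_pos[OF assms(2)] by (simp add: norm_mult norm_power)
  ultimately show ?thesis
    by (simp add: power_divide)
qed

lemma norm_kappa_mult_power_less_1:
  assumes "0 < r" "r < s" "p = real r / real s" "norm \<epsilon> < u_star p"
  shows "norm (of_real (kappa r s) * \<epsilon> ^ s :: complex) < 1"
proof -
  have "u_star p > 0" using assms(4) norm_ge_zero[of \<epsilon>] by linarith
  then have "0 \<le> norm \<epsilon> / u_star p" "norm \<epsilon> / u_star p < 1" using assms(4) by simp_all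
  then show ?thesis
    unfolding norm_kappa_mult_power[OF assms(1-3)]
    using assms(2) by (simp add: power_less_one_iff del: divide_less_eq_1_pos)
qed

lemma summable_norm_hypergeom_term_A_B:
  assumes "r < s" "j \<in> {1..s}" "norm x < 1"
  shows "summable (\<lambda>m. norm (hypergeom_term (A_mset r s j) (B_mset r s j) x m))"
  unfolding hypergeom_term_eq
  using assms(3) conv_radius_hypergeom_coeff_A_B[OF assms(1,2)]
  by (intro abs_summable_in_conv_radius) simp

text \<open>The index \<open>Suc (m * s + i)\<close> is \<open>j + s * m\<close> for \<open>j = i + 1\<close>: the shift by one moves the residues
  \<open>0, \<dots>, s - 1\<close> to the representatives \<open>1, \<dots>, s\<close> and leaves out the index \<open>0\<close>, which is not
  part of the series for \<open>z\<close>.\<close>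

lemma summable_norm_z_coeff_residue_class:
  assumes "0 < r" "r < s" "p = real r / real s" "norm \<epsilon> < u_star p" "i < s"
  shows "summable (\<lambda>m. norm (z_coeff p (Suc (m * s + i)) * \<epsilon> ^ Suc (m * s + i)))"
proof -
  have i: "Suc i \<in> {1..s}" using assms(5) by auto
  have index: "Suc (m * s + i) = Suc i + s * m" for m by simp
  show ?thesis
    unfolding index z_coeff_term_eq_hypergeom_term[OF assms(2,3) i] norm_mult
    by (intro summable_mult summable_norm_hypergeom_term_A_B[OF assms(2) i]
          norm_kappa_mult_power_less_1[OF assms(1-4)])
qed

lemma z_eq_sum_hypergeom:
  assumes "0 < r" "r < s" "p = real r / real s" "norm \<epsilon> < u_star p"
  shows "z p \<epsilon> = 1 - (\<Sum>j=1..s. of_real (C_coeff r s j) * \<epsilon> ^ j *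
           hypergeom (A_mset r s j) (B_mset r s j) (of_real (kappa r s) * \<epsilon> ^ s))"
proof -
  let ?x = "of_real (kappa r s) * \<epsilon> ^ s"
  let ?h = "\<lambda>j. hypergeom_term (A_mset r s j) (B_mset r s j) ?x"
  have inner: "(\<Sum>m. z_coeff p (Suc (m * s + i)) * \<epsilon> ^ Suc (m * s + i)) =
      of_real (C_coeff r s (Suc i)) * \<epsilon> ^ Suc i * (\<Sum>m. ?h (Suc i) m)" if "i < s" for i
  proof -
    have i: "Suc i \<in> {1..s}" using that by auto
    have index: "Suc (m * s + i) = Suc i + s * m" for m by simp
    have "summable (?h (Suc i))"
      using summable_norm_hypergeom_term_A_B[OF assms(2) i norm_kappa_mult_power_less_1[OF assms]]
      by (rule summable_norm_cancel)
    then show ?thesis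
      unfolding index z_coeff_term_eq_hypergeom_term[OF assms(2,3) i] by (rule suminf_mult)
  qed
  have "(\<Sum>n. z_coeff p (Suc n) * \<epsilon> ^ Suc n) =
      (\<Sum>i<s. \<Sum>m. z_coeff p (Suc (m * s + i)) * \<epsilon> ^ Suc (m * s + i))"
    using assms by (intro suminf_split_residue_classes[where f = "\<lambda>n. z_coeff p (Suc n) * \<epsilon> ^ Suc n"]
      summable_norm_z_coeff_residue_class) auto
  also have "\<dots> = (\<Sum>i<s. of_real (C_coeff r s (Suc i)) * \<epsilon> ^ Suc i * (\<Sum>m. ?h (Suc i) m))"
    using inner by (intro sum.cong) auto
  also have "\<dots> = (\<Sum>j=1..s. of_real (C_coeff r s j) * \<epsilon> ^ j * (\<Sum>m. ?h j m))"
    by (rule sum.reindex_bij_witness[of _ "\<lambda>j. j - 1" Suc]) auto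
  finally show ?thesis by (simp add: z_def hypergeom_def)
qed

lemma C_coeff_pos:
  assumes "r < s" "j \<ge> 1"
  shows "C_coeff r s j > 0"
  using alpha_pos[OF assms] beta_pos[OF assms] by (simp add: C_coeff_def Gamma_real_pos)

text \<open>Below \<open>u_star p\<close> all residue classes converge absolutely, hence so does the whole series. If it
  converged absolutely for some \<open>t > u_star p\<close>, so would its subseries in the class of \<open>1\<close>, a
  nonzero multiple of a hypergeometric series at an argument of modulus greater than \<open>1\<close>.\<close>

lemma conv_radius_z_coeff:
  assumes "0 < r" "r < s" "p = real r / real s"
  shows "conv_radius (z_coeff p) = ereal (u_star p)"
proof (rule antisym)
  have u: "u_star p > 0" using assms by (intro u_star_pos) auto
  have s: "s > 0" using assms by simp
  show "conv_radius (z_coeff p) \<ge> ereal (u_star p)"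
  proof (rule conv_radius_geI_ex')
    fix t :: real assume t: "0 < t" "ereal t < ereal (u_star p)"
    let ?f = "\<lambda>n. z_coeff p n * of_real t ^ n"
    have "summable (\<lambda>n. norm (?f (Suc n)))"
      using summable_norm_z_coeff_residue_class[OF assms, of "of_real t"] t s
      by (intro summable_norm_of_residue_classes[where f = "\<lambda>n. ?f (Suc n)"]) auto
    then have "summable (\<lambda>n. ?f (Suc n))"
      by (rule summable_norm_cancel)
    then show "summable ?f"
      by (rule summable_Suc_iff[of ?f, THEN iffD1])
  qed
  show "conv_radius (z_coeff p) \<le> ereal (u_star p)"
  proof (rule conv_radius_leI_ex)
    fix t :: real assume t: "0 < t" "ereal t > ereal (u_star p)"
    let ?f = "\<lambda>n. norm (z_coeff p n * of_real t ^ n)"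
    let ?x = "of_real (kappa r s) * of_real t ^ s :: complex"
    have j: "(1::nat) \<in> {1..s}" using s by auto
    have "\<not> summable ?f"
    proof
      assume "summable ?f"
      then have "summable (?f \<circ> (\<lambda>m. 1 + s * m))"
        using s by (intro summable_reindex) (auto simp: inj_on_def)
      then have "summable (\<lambda>m. norm (of_real (C_coeff r s 1) * of_real t ^ 1 :: complex) *
          norm (hypergeom_term (A_mset r s 1) (B_mset r s 1) ?x m))"
        unfolding o_def z_coeff_term_eq_hypergeom_term[OF assms(2,3) j]
        by (simp only: norm_mult)
      moreover have "norm (of_real (C_coeff r s 1) * of_real t ^ 1 :: complex) \<noteq> 0"
        using C_coeff_pos[OF assms(2), of 1] t by simp
      ultimately have "summable (\<lambda>m. norm (hypergeom_term (A_mset r s 1) (B_mset r s 1) ?x m))"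
        by (simp add: summable_cmult_iff)
      then have "ereal (norm ?x) \<le> conv_radius (hypergeom_coeff (A_mset r s 1) (B_mset r s 1))"
        unfolding hypergeom_term_eq by (intro conv_radius_geI) (rule summable_norm_cancel)
      then have "norm ?x \<le> 1"
        unfolding conv_radius_hypergeom_coeff_A_B[OF assms(2) j] by simp
      moreover have "norm ?x > 1"
        unfolding norm_kappa_mult_power[OF assms] using t u s by (intro one_less_power) auto
      ultimately show False by simp
    qed
    then show "\<exists>y. norm y = t \<and> \<not> summable (\<lambda>n. norm (z_coeff p n * y ^ n))"
      using t by (intro exI[of _ "of_real t"]) auto
  qed (use u in auto)
qed

theorem proposition4p1:
  fixes p :: real and r s :: nat
  assumes "r > 0" and "s > 0" and "coprime r s"
    and "p = real r / real s" and "0 < p" and "p < 1"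
  shows "(\<forall>\<epsilon>::complex. norm \<epsilon> < u_star p \<longrightarrow>
            (\<forall>j\<in>{1..s}. summable
               (hypergeom_term (A_mset r s j) (B_mset r s j) (complex_of_real (kappa r s) * \<epsilon> ^ s))) \<and>
            z p \<epsilon> = 1 - (\<Sum>j=1..s. complex_of_real (C_coeff r s j) * \<epsilon> ^ j *
               hypergeom (A_mset r s j) (B_mset r s j) (complex_of_real (kappa r s) * \<epsilon> ^ s)))
       \<and> kappa r s * u_star p ^ s = 1
       \<and> conv_radius (z_coeff p) = ereal (u_star p)
       \<and> (\<forall>\<epsilon>::complex. norm \<epsilon> < u_star p \<longrightarrow> norm (complex_of_real (kappa r s) * \<epsilon> ^ s) < 1)"
proof -
  have rs: "r < s" using assms by simp
  note p = assms(1) rs assms(4)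
  show ?thesis
  proof (intro conjI allI impI ballI)
    fix \<epsilon> :: complex assume \<epsilon>: "norm \<epsilon> < u_star p"
    note x = norm_kappa_mult_power_less_1[OF p \<epsilon>]
    show "norm (complex_of_real (kappa r s) * \<epsilon> ^ s) < 1"
      by (rule x)
    show "summable (hypergeom_term (A_mset r s j) (B_mset r s j)
        (complex_of_real (kappa r s) * \<epsilon> ^ s))" if "j \<in> {1..s}" for j
      using summable_norm_hypergeom_term_A_B[OF rs that x] by (rule summable_norm_cancel)
    show "z p \<epsilon> = 1 - (\<Sum>j=1..s. complex_of_real (C_coeff r s j) * \<epsilon> ^ j *
        hypergeom (A_mset r s j) (B_mset r s j) (complex_of_real (kappa r s) * \<epsilon> ^ s))"
      by (rule z_eq_sum_hypergeom[OF p \<epsilon>])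
  qed (rule kappa_mult_u_star_power[OF p] conv_radius_z_coeff[OF p])+
qed

end
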